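(* In an FFBtree (a B$^{+}$-tree whose insertions are all performed by the proactive-split insertion algorithm described in the context), split propagation cannot take place. That is, during any insertion, the split of a node never forces a split of its parent.
   Context: **B$^{+}$-tree.** A self-balancing search tree in which all leaves are at the same depth. Each node is one page with a fixed capacity (a maximum number of entries/slots). Leaves store key-value data. A non-leaf node $N$ stores separator keys and pointers to its children $N.chd[1],\dots,N.chd[|N.chd|]$. Height is the number of levels, so a tree of height one is a single leaf, which is the root. Splitting a node replaces it by two nodes, each receiving about half of its entries, and inserts one new separator/child entry into the parent, consuming one free slot of the parent. Splitting the root creates a new root. A node is full if it has no free slot. **Split propagation.** The split of a node inserts a new entry into its parent, and the parent, having no free slot to accommodate it, must itself be split, so that one insertion causes a cascade of splits of several nodes along a root-to-leaf path. **Free space.** $F(N)$ is the free space (number of free slots) in node $N$ after the next insert into $N$'s subtree, assuming no split at $N$. **Safe/unsafe.** A node $N$ is safe if, for any next insert into the subtree rooted at $N$, the resulting state of $N$ stays within capacity and no split is required at $N$. It is unsafe if some next insert into its subtree would trigger a split at $N$ (possibly as part of a split propagating from below). **Critical.** A leaf $N$ is critical if $F(N)=0$, i.e. it is full. A non-leaf $N$ is critical if $F(N)=s(N)$, where $$s(N)=\sum_{i=1}^{|N.chd|}\big(\mathrm{critical}(N.chd[i])+\mathrm{unsafe}(N.chd[i])\big),$$ predicates evaluating to 1 or 0. The quantity $s(N)$ is the number of children of $N$ that are critical or unsafe, so $N$'s free space is just sufficient to accommodate one split per critical or unsafe child (a full leaf, being both critical and unsafe, is counted once). **Classification of non-leaf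 nodes.** A non-leaf node is safe non-critical if $F(N)>s(N)$, critical if $F(N)=s(N)$ (a critical non-leaf node is still regarded as safe), and unsafe if $F(N)<s(N)$. **FFBtree.** A B$^{+}$-tree, built from the empty tree by a sequence of insertions with no deletions, where each insertion of $(k,v)$ is executed as follows. 1. Set $cur=root$, $last=null$. 2. Descend from the root to the leaf destined for $k$ by the usual key comparisons. At every visited node $cur$ (including the leaf), if $cur$ is critical, set $last=cur$. Thus at the end $last$ is the critical node on the path closest to the leaf level, if any. 3. If $last\neq null$, split $last$ (a *proactive split* ) and insert the new split node into the parent of $last$. 4. Insert $(k,v)$ into the destination leaf. 5. Update the information recording which nodes are critical.
   Formalization: Adds that leaves hold at least 4 entries and non-leaf nodes at least 5 children; with smaller pages the claim fails (e.g. leaf capacity 3, splits 1|2, ascending keys). "About half" is read as floor or ceiling of half, fixed per node size. *)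

theory Defs
  imports Main
begin

text \<open>
  \<open>Node t0 [(k1, t1), \<dots>, (km, tm)]\<close> has the children \<open>t0, t1, \<dots>, tm\<close>; the separator
  \<open>ki\<close> is the least key that is routed to \<open>ti\<close> or further to the right.
\<close>

datatype ('k, 'v) bptree =
    Leaf "('k \<times> 'v) list"
  | Node "('k, 'v) bptree" "('k \<times> ('k, 'v) bptree) list"

fun chd :: "('k, 'v) bptree \<Rightarrow> ('k, 'v) bptree list" where
  "chd (Leaf es) = []"
| "chd (Node t0 es) = t0 # map snd es"

text \<open>
  A slot of a leaf holds one key-value pair, a slot of a non-leaf node one child pointer.
  The two kinds of pages may have different capacities \<open>cl\<close> and \<open>ci\<close>.
  $F(N)$ is taken in the state left behind by the most recent insertion, so that $F(N) = 0$ means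
  that a leaf is full and a full leaf is both critical and unsafe.
\<close>

fun free_space :: "nat \<Rightarrow> nat \<Rightarrow> ('k, 'v) bptree \<Rightarrow> nat" where
  "free_space cl ci (Leaf es) = cl - length es"
| "free_space cl ci (Node t0 es) = ci - length (chd (Node t0 es))"

text \<open>The third function is the quantity $s(N)$.\<close>

fun critical :: "nat \<Rightarrow> nat \<Rightarrow> ('k, 'v) bptree \<Rightarrow> bool"
  and unsafe :: "nat \<Rightarrow> nat \<Rightarrow> ('k, 'v) bptree \<Rightarrow> bool"
  and endangered :: "nat \<Rightarrow> nat \<Rightarrow> ('k, 'v) bptree \<Rightarrow> nat" where
  "critical cl ci (Leaf es) \<longleftrightarrow> free_space cl ci (Leaf es) = 0"
| "critical cl ci (Node t0 es) \<longleftrightarrow>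
     free_space cl ci (Node t0 es) = endangered cl ci (Node t0 es)"
| "unsafe cl ci (Leaf es) \<longleftrightarrow> free_space cl ci (Leaf es) = 0"
| "unsafe cl ci (Node t0 es) \<longleftrightarrow>
     free_space cl ci (Node t0 es) < endangered cl ci (Node t0 es)"
| "endangered cl ci (Leaf es) = 0"
| "endangered cl ci (Node t0 es) =
     (\<Sum>c\<leftarrow>t0 # map snd es. of_bool (critical cl ci c \<or> unsafe cl ci c))"

definition child_index :: "'k::linorder \<Rightarrow> ('k \<times> ('k, 'v) bptree) list \<Rightarrow> nat" where
  "child_index k es = length (takeWhile (\<lambda>(s, _). s \<le> k) es)"

lemma child_index_less: "child_index k es < length (chd (Node t0 es))"
  by (simp add: child_index_def less_Suc_eq_le length_takeWhile_le)

lemma size_chd_nth [termination_simp]: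
  "size ((t0 # map snd es) ! child_index k es)
     < Suc (size_list (\<lambda>e. Suc (size (snd e))) es + size t0)"
proof -
  have "size t < Suc (size_list (\<lambda>e. Suc (size (snd e))) es + size t0)"
    if "t \<in> set (t0 # map snd es)" for t
  proof (cases "t = t0")
    case False
    with that obtain e where "e \<in> set es" "t = snd e" by auto
    then have "size t \<le> size_list (\<lambda>e. Suc (size (snd e))) es"
      by (intro size_list_estimation'[of e]) auto
    then show ?thesis by simp
  qed simp
  moreover have "child_index k es < length (t0 # map snd es)"
    using child_index_less[of k es t0] by simp
  ultimately show ?thesis by (metis nth_mem)
qed

text \<open>
  A node of the search path for \<open>k\<close> is denoted by its depth, the root having depth 0.
  \<open>last_critical\<close> carries the depth \<open>d\<close> of the current node and the value \<open>l\<close> of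
  \<open>last\<close>, with \<open>None\<close> for \<open>null\<close>. Criticality is evaluated in the tree left behind by the
  preceding insertion; this is the information that the preceding insertion has recorded.
\<close>

fun last_critical ::
  "nat \<Rightarrow> nat \<Rightarrow> 'k::linorder \<Rightarrow> nat \<Rightarrow> nat option \<Rightarrow> ('k, 'v) bptree \<Rightarrow> nat option" where
  "last_critical cl ci k d l (Leaf es) =
     (if critical cl ci (Leaf es) then Some d else l)"
| "last_critical cl ci k d l (Node t0 es) =
     last_critical cl ci k (Suc d)
       (if critical cl ci (Node t0 es) then Some d else l)
       (chd (Node t0 es) ! child_index k es)"

text \<open>
  An operation on a subtree leaves a single node in its place, or two nodes with a separator
  between them that still have to be entered into the parent.
\<close>

datatype ('k, 'v) outcome =
    Whole "('k, 'v) bptree"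
  | Split "('k, 'v) bptree" 'k "('k, 'v) bptree"

text \<open>
  \<open>mid n\<close> is the number of entries that the left half of a node with \<open>n\<close> entries receives.
  A non-leaf node with \<open>n\<close> children has \<open>n - 1\<close> separators, and the one between the two
  halves moves up.
\<close>

fun split_node :: "(nat \<Rightarrow> nat) \<Rightarrow> ('k, 'v) bptree \<Rightarrow> ('k, 'v) outcome" where
  "split_node mid (Leaf es) =
     (let m = mid (length es) in Split (Leaf (take m es)) (fst (es ! m)) (Leaf (drop m es)))"
| "split_node mid (Node t0 es) =
     (let m = mid (length (chd (Node t0 es))); (s, t) = es ! (m - 1)
      in Split (Node t0 (take (m - 1) es)) s (Node t (drop m es)))"

fun replace_child ::
  "nat \<Rightarrow> ('k, 'v) bptree \<Rightarrow> ('k, 'v) bptree \<Rightarrow> ('k \<times> ('k, 'v) bptree) list \<Rightarrow> ('k, 'v) bptree"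
where
  "replace_child 0 t t0 es = Node t es"
| "replace_child (Suc j) t t0 es = Node t0 (es[j := (fst (es ! j), t)])"

fun add_entry :: "nat \<Rightarrow> 'k \<Rightarrow> ('k, 'v) bptree \<Rightarrow> ('k, 'v) bptree \<Rightarrow> ('k, 'v) bptree" where
  "add_entry i s t (Leaf es) = Leaf es"
| "add_entry i s t (Node t0 es) = Node t0 (take i es @ (s, t) # drop i es)"

text \<open>
  \<open>absorb\<close> passes the outcome at child \<open>i\<close> of \<open>Node t0 es\<close> on to that node. If the child has
  been split and the node has no free slot for the new entry, the node is split as well. The
  number in the second component counts the splits forced in this way by the split of a child.
\<close>

fun absorb ::
  "nat \<Rightarrow> nat \<Rightarrow> (nat \<Rightarrow> nat) \<Rightarrow> ('k, 'v) bptree \<Rightarrow> ('k \<times> ('k, 'v) bptree) list \<Rightarrow> nat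
   \<Rightarrow> ('k, 'v) outcome \<times> nat \<Rightarrow> ('k, 'v) outcome \<times> nat"
where
  "absorb cl ci mid t0 es i (Whole t, n) = (Whole (replace_child i t t0 es), n)"
| "absorb cl ci mid t0 es i (Split l s r, n) =
     (let N = add_entry i s r (replace_child i l t0 es)
      in if free_space cl ci (Node t0 es) > 0 then (Whole N, n)
         else (split_node mid N, Suc n))"

fun split_at ::
  "nat \<Rightarrow> nat \<Rightarrow> (nat \<Rightarrow> nat) \<Rightarrow> 'k::linorder \<Rightarrow> nat \<Rightarrow> ('k, 'v) bptree \<Rightarrow> ('k, 'v) outcome \<times> nat"
where
  "split_at cl ci mid k 0 t = (split_node mid t, 0)"
| "split_at cl ci mid k (Suc d) (Leaf es) = (Whole (Leaf es), 0)"
| "split_at cl ci mid k (Suc d) (Node t0 es) =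
     (let i = child_index k es
      in absorb cl ci mid t0 es i (split_at cl ci mid k d (chd (Node t0 es) ! i)))"

definition upsert :: "'k::linorder \<Rightarrow> 'v \<Rightarrow> ('k \<times> 'v) list \<Rightarrow> ('k \<times> 'v) list" where
  "upsert k v es =
     takeWhile (\<lambda>(k', _). k' < k) es @ (k, v) # dropWhile (\<lambda>(k', _). k' \<le> k) es"

text \<open>
  The usual B$^+$-tree insertion: a leaf that would exceed its capacity is split, and this split
  is handed to the parent like any other.
\<close>

fun leaf_insert ::
  "nat \<Rightarrow> nat \<Rightarrow> (nat \<Rightarrow> nat) \<Rightarrow> 'k::linorder \<Rightarrow> 'v \<Rightarrow> ('k, 'v) bptree \<Rightarrow> ('k, 'v) outcome \<times> nat"
where
  "leaf_insert cl ci mid k v (Leaf es) =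
     (let es' = upsert k v es
      in (if length es' \<le> cl then Whole (Leaf es') else split_node mid (Leaf es'), 0))"
| "leaf_insert cl ci mid k v (Node t0 es) =
     (let i = child_index k es
      in absorb cl ci mid t0 es i (leaf_insert cl ci mid k v (chd (Node t0 es) ! i)))"

fun new_root :: "('k, 'v) outcome \<Rightarrow> ('k, 'v) bptree" where
  "new_root (Whole t) = t"
| "new_root (Split l s r) = Node l [(s, r)]"

text \<open>
  One insertion, returning the new tree and the number of splits that were forced by the split
  of a child.
\<close>

definition ffb_insert ::
  "nat \<Rightarrow> nat \<Rightarrow> (nat \<Rightarrow> nat) \<Rightarrow> 'k::linorder \<Rightarrow> 'v \<Rightarrow> ('k, 'v) bptree \<Rightarrow> ('k, 'v) bptree \<times> nat"
where
  "ffb_insert cl ci mid k v t =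
     (let (t1, n1) = (case last_critical cl ci k 0 None t of
                        None \<Rightarrow> (t, 0)
                      | Some d \<Rightarrow> apfst new_root (split_at cl ci mid k d t));
          (t2, n2) = apfst new_root (leaf_insert cl ci mid k v t1)
      in (t2, n1 + n2))"

inductive ffbtree :: "nat \<Rightarrow> nat \<Rightarrow> (nat \<Rightarrow> nat) \<Rightarrow> ('k::linorder, 'v) bptree \<Rightarrow> bool"
  for cl ci mid
where
  empty: "ffbtree cl ci mid (Leaf [])"
| insert: "ffbtree cl ci mid t \<Longrightarrow> ffbtree cl ci mid (fst (ffb_insert cl ci mid k v t))"

definition split_propagates ::
  "nat \<Rightarrow> nat \<Rightarrow> (nat \<Rightarrow> nat) \<Rightarrow> ('k::linorder, 'v) bptree \<Rightarrow> 'k \<Rightarrow> 'v \<Rightarrow> bool"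
where
  "split_propagates cl ci mid t k v \<longleftrightarrow> snd (ffb_insert cl ci mid k v t) > 0"

end

theory Submission
  imports Defs
begin

text \<open>
  Call a node hot if it is critical or unsafe, and let each child weigh 2 if it is hot and 1
  otherwise. Since the number of children plus $s(N)$ is the total weight of the children, a
  non-leaf node is hot iff this weight reaches the capacity, just as a leaf is hot iff its length
  does. The invariant is that no weight exceeds its capacity and that the keys are in order.

  Below a proactive split the path contains no critical node, so the insertion raises each weight
  there by at most 1 and no leaf overflows. The split itself replaces a child of weight 2 by two
  children of weight 1, so the weight of the parent does not change; and the half that the path
  enters has weight at most its capacity minus 2, so it does not become hot in the subsequent
  insertion and nothing changes further up. A hot child also makes the weight of its parent exceed
  the number of children, hence the parent has a free slot for the split. The order of the keys
  ensures that the descent after the split follows the same path as the one before.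
\<close>

section \<open>Key order along the search path\<close>

fun inorder :: "('k, 'v) bptree \<Rightarrow> 'k list" where
  "inorder (Leaf es) = map fst es"
| "inorder (Node t0 es) = inorder t0 @ concat (map (\<lambda>(s, t). s # inorder t) es)"

text \<open>
  The neighbouring keys \<open>xs\<close> and \<open>ys\<close> make the relation compositional along the search path
  for \<open>k\<close>.
\<close>

definition fits :: "'k::linorder \<Rightarrow> 'k list \<Rightarrow> 'k list \<Rightarrow> bool" where
  "fits k as bs \<longleftrightarrow>
     (\<forall>xs ys. sorted (xs @ as @ ys) \<longrightarrow> (\<forall>x\<in>set xs. x \<le> k) \<longrightarrow> (\<forall>y\<in>set ys. k \<le> y) \<longrightarrow>
        sorted (xs @ bs @ ys))"

lemma fits_sorted: "fits k as bs \<Longrightarrow> sorted as \<Longrightarrow> sorted bs"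
  unfolding fits_def by (metis append_Nil append_Nil2 empty_iff list.set(1))

text \<open>Since \<open>pre\<close> is sorted and, unless empty, ends with a separator
  \<open>\<le> k\<close>, all its keys are \<open>\<le> k\<close>, and dually for
  \<open>post\<close>; so both can be counted among the neighbours \<open>xs\<close> and
  \<open>ys\<close> of the assumption.\<close>

lemma fits_context:
  assumes "fits k as bs"
    and "pre = [] \<or> (\<exists>p s. pre = p @ [s] \<and> s \<le> k)"
    and "post = [] \<or> (\<exists>p s. post = s # p \<and> k < s)"
  shows "fits k (pre @ as @ post) (pre @ bs @ post)"
  unfolding fits_def
proof (intro allI impI)
  fix xs ys
  assume so: "sorted (xs @ (pre @ as @ post) @ ys)"
    and xs: "\<forall>x\<in>set xs. x \<le> k" and ys: "\<forall>y\<in>set ys. k \<le> y"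
  have "sorted pre" "sorted post" using so by (simp_all add: sorted_append)
  then have "\<forall>x\<in>set pre. x \<le> k" "\<forall>y\<in>set post. k \<le> y"
    using assms(2,3) by (auto simp: sorted_append) (meson less_imp_le order_trans)+
  then have "\<forall>x\<in>set (xs @ pre). x \<le> k" "\<forall>y\<in>set (post @ ys). k \<le> y"
    using xs ys by (simp_all add: ball_Un)
  moreover have "sorted ((xs @ pre) @ as @ post @ ys)"
    using so by (simp only: append_assoc)
  ultimately have "sorted ((xs @ pre) @ bs @ post @ ys)"
    using assms(1) unfolding fits_def by blast
  then show "sorted (xs @ (pre @ bs @ post) @ ys)"
    by (simp only: append_assoc)
qed

text \<open>The only new key is \<open>k\<close> itself, and the neighbours are bounded by
  \<open>k\<close>; sortedness of \<open>es\<close> puts the entries kept after the inserted one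
  above \<open>k\<close>.\<close>

lemma fits_upsert: "fits k (map fst es) (map fst (upsert k v es))"
  unfolding fits_def
proof (intro allI impI)
  fix xs ys
  assume so: "sorted (xs @ map fst es @ ys)"
    and xs: "\<forall>x\<in>set xs. x \<le> k" and ys: "\<forall>y\<in>set ys. k \<le> y"
  let ?T = "takeWhile (\<lambda>(k', _). k' < k) es" and ?D = "dropWhile (\<lambda>(k', _). k' \<le> k) es"
  have T: "set ?T \<subseteq> set es" "\<forall>e\<in>set ?T. fst e < k"
    by (auto dest: set_takeWhileD)
  have D: "set ?D \<subseteq> set es" by (auto dest: set_dropWhileD)
  have sT: "sorted (map fst ?T)" and sD: "sorted (map fst ?D)"
    using so by (simp_all add: sorted_append sorted_map)
  have Dk: "k \<le> fst e" if "e \<in> set ?D" for e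
  proof (cases ?D)
    case (Cons d D')
    then have "k < fst d" by (metis case_prod_beta hd_dropWhile leI list.distinct(1) list.sel(1))
    then show ?thesis using that sD Cons by auto
  qed (use that in \<open>metis empty_iff list.set(1)\<close>)
  show "sorted (xs @ map fst (upsert k v es) @ ys)"
  proof -
    have S: "sorted xs" "sorted ys" "\<And>x y. x \<in> set xs \<Longrightarrow> y \<in> set ys \<Longrightarrow> x \<le> y"
      "\<And>x e. x \<in> set xs \<Longrightarrow> e \<in> set es \<Longrightarrow> x \<le> fst e"
      "\<And>e y. e \<in> set es \<Longrightarrow> y \<in> set ys \<Longrightarrow> fst e \<le> y"
      using so by (auto simp: sorted_append)
    have "fst e \<le> fst e'" if "e \<in> set ?T" "e' \<in> set ?D" for e e'
      using T(2) Dk that by (meson less_imp_le order_trans)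
    then show ?thesis
      unfolding upsert_def map_append list.map sorted_append sorted_simps set_append set_map
        list.set fst_conv
      using S sT sD Dk T D xs ys by (auto dest: less_imp_le)
  qed
qed

text \<open>The kept prefix of keys \<open>< k\<close> is no longer than the dropped prefix of keys
  \<open>\<le> k\<close>, so at most one entry is gained.\<close>

lemma length_upsert: "length (upsert k v es) \<le> Suc (length es)"
proof -
  have "length (takeWhile (\<lambda>(k', _). k' < k) es) \<le> length (takeWhile (\<lambda>(k', _). k' \<le> k) es)"
    by (induction es) auto
  then show ?thesis
    using arg_cong[OF takeWhile_dropWhile_id[of "\<lambda>(k', _). k' \<le> k" es], of length]
    by (simp add: upsert_def del: takeWhile_dropWhile_id)
qed

section \<open>Positions of children: replacing one and entering a new one\<close>

lemma child_index_seps: "child_index k es = length (takeWhile (\<lambda>s. s \<le> k) (map fst es))"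
  by (simp add: child_index_def takeWhile_map comp_def case_prod_unfold)

lemma child_index_le: "child_index k es \<le> length es"
  by (simp add: child_index_def length_takeWhile_le)

text \<open>Used with \<open>P\<close> as \<open>\<lambda>s. s \<le> k\<close> on the separators: it
  tells which half the search for \<open>k\<close> enters once the separator of a split child has
  been added.\<close>

lemma takeWhile_insert:
  "length (takeWhile P (take (length (takeWhile P xs)) xs @ s # drop (length (takeWhile P xs)) xs))
     = (if P s then Suc (length (takeWhile P xs)) else length (takeWhile P xs))"
  by (induction xs) auto

text \<open>The leftmost child has no separator of its own and \<open>replace_child\<close> treats
  it apart, hence the two cases.\<close>

lemma child_cases:
  assumes "i \<le> length es"
  obtains (first) "i = 0"
  | (later) as s0 c bs where "es = as @ (s0, c) # bs" "i = Suc (length as)"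
proof (cases i)
  case (Suc j)
  then show ?thesis using assms later[of "take j es" "fst (es ! j)" "snd (es ! j)" "drop (Suc j) es"]
    by (simp add: id_take_nth_drop[symmetric] Suc_le_eq)
qed (rule first)

lemma replace_child_Node:
  assumes "i \<le> length es"
  obtains t1 es1 where "replace_child i u t0 es = Node t1 es1" "map fst es1 = map fst es"
    "t1 # map snd es1 = (t0 # map snd es)[i := u]"
  using assms
proof (cases rule: child_cases)
  case first
  then show ?thesis using that by simp
next
  case (later as s0 c bs)
  have "(t0 # map snd es)[i := u] = t0 # map snd (as @ (s0, u) # bs)"
    using later by (simp add: list_update_append)
  then show ?thesis using that[of t0 "as @ (s0, u) # bs"] later by simp
qed

lemma add_entry_Node:
  assumes "i \<le> length es"
  obtains t1 es1 where "add_entry i s r (replace_child i l t0 es) = Node t1 es1"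
    "map fst es1 = take i (map fst es) @ s # drop i (map fst es)"
    "t1 # map snd es1 = take i (t0 # map snd es) @ l # r # drop (Suc i) (t0 # map snd es)"
  using assms
proof (cases rule: child_cases)
  case first
  then show ?thesis using that by simp
next
  case (later as s0 c bs)
  then show ?thesis using that by simp
qed

text \<open>Unless empty, \<open>pre\<close> ends with the separator left of the chosen child and
  \<open>post\<close> begins with the one right of it, which are the bounds that
  \<open>fits_context\<close> asks for; both lists are independent of what replaces the
  child.\<close>

lemma inorder_context:
  fixes k :: "'k::linorder" and t0 :: "('k, 'v) bptree" and es :: "('k \<times> ('k, 'v) bptree) list"
  defines "i \<equiv> child_index k es" and "N \<equiv> Node t0 es"
  obtains pre post where
    "\<And>u. inorder (replace_child i u t0 es) = pre @ inorder u @ post"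
    "\<And>l s r. inorder (add_entry i s r (replace_child i l t0 es)) = pre @ inorder l @ s # inorder r @ post"
    "\<And>bs. fits k (inorder (chd N ! i)) bs \<Longrightarrow> fits k (inorder N) (pre @ bs @ post)"
proof -
  have le: "i \<le> length es" unfolding i_def by (rule child_index_le)
  have left: "fst (es ! j) \<le> k" if "j < i" for j
    using that le nth_mem[of j "takeWhile (\<lambda>(s, _). s \<le> k) es"]
    by (auto simp: i_def child_index_def takeWhile_nth dest!: set_takeWhileD split: prod.splits)
  have right: "k < fst (es ! i)" if "i < length es"
    using that nth_length_takeWhile[of "\<lambda>(s, _). s \<le> k" es]
    by (auto simp: i_def child_index_def split: prod.splits)
  show ?thesis
    using le
  proof (cases rule: child_cases)
    case first
    let ?post = "concat (map (\<lambda>(s, t). s # inorder t) es)"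
    have "?post = [] \<or> (\<exists>p s. ?post = s # p \<and> k < s)"
      using right first by (cases es) auto
    then show ?thesis
      using that[of "[]" ?post] fits_context[of k "inorder t0" _ "[]" ?post] first
      by (simp add: N_def)
  next
    case (later as s0 c bs)
    let ?pre = "inorder t0 @ concat (map (\<lambda>(s, t). s # inorder t) as) @ [s0]"
    let ?post = "concat (map (\<lambda>(s, t). s # inorder t) bs)"
    have "s0 \<le> k" using left[of "length as"] later by simp
    moreover have "?post = [] \<or> (\<exists>p s. ?post = s # p \<and> k < s)"
      using right later by (cases bs) (auto simp: nth_append)
    ultimately show ?thesis
      using that[of ?pre ?post] fits_context[of k "inorder c" _ ?pre ?post] later
      by (simp add: N_def nth_append)
  qed
qed

lemma sorted_inorder_child:
  assumes "sorted (inorder (Node t0 es))"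
  shows "sorted (inorder (chd (Node t0 es) ! child_index k es))"
  using child_index_le
proof (cases rule: child_cases[of "child_index k es" es])
  case (later as s0 c bs)
  then show ?thesis using assms by (simp add: nth_append sorted_append)
qed (use assms in \<open>auto simp: sorted_append\<close>)

text \<open>The search picks a child by index, so \<open>last_critical_acc\<close> and
  \<open>insert_noncritical_path\<close> induct on \<open>size\<close>. The proof reconciles two
  forms of the size of the entry list.\<close>

lemma size_child: "size (chd (Node t0 es) ! child_index k es) < size (Node t0 es)"
proof -
  have "size_list (size_prod (\<lambda>x. 0) size) es = size_list (\<lambda>e. Suc (size (snd e))) es"
    by (induction es) auto
  then show ?thesis using size_chd_nth[of t0 es k] by simp
qed

section \<open>Weights, loads and the invariant \<open>within\<close>\<close>

locale ffb =
  fixes cl ci :: nat and mid :: "nat \<Rightarrow> nat"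
  assumes cl: "cl \<ge> 4" and ci: "ci \<ge> 5"
    and mid: "mid n = n div 2 \<or> mid n = n - n div 2"
begin

abbreviation hot :: "('k, 'v) bptree \<Rightarrow> bool" where
  "hot t \<equiv> critical cl ci t \<or> unsafe cl ci t"

definition weight :: "('k, 'v) bptree \<Rightarrow> nat" where
  "weight t = (if hot t then 2 else 1)"

fun load :: "('k, 'v) bptree \<Rightarrow> nat" where
  "load (Leaf es) = length es"
| "load (Node t0 es) = sum_list (map weight (t0 # map snd es))"

fun cap :: "('k, 'v) bptree \<Rightarrow> nat" where
  "cap (Leaf es) = cl"
| "cap (Node t0 es) = ci"

fun within :: "('k, 'v) bptree \<Rightarrow> bool" where
  "within (Leaf es) \<longleftrightarrow> length es \<le> cl"
| "within (Node t0 es) \<longleftrightarrow>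
     within t0 \<and> (\<forall>e\<in>set es. within (snd e)) \<and> load (Node t0 es) \<le> ci"

lemma within_Node:
  "within (Node t0 es) \<longleftrightarrow>
     (\<forall>c\<in>set (t0 # map snd es). within c) \<and> sum_list (map weight (t0 # map snd es)) \<le> ci"
  by auto

lemma within_load: "within t \<Longrightarrow> load t \<le> cap t"
  by (cases t) auto

lemma load_eq: "load (Node t0 es) = length (chd (Node t0 es)) + endangered cl ci (Node t0 es)"
proof -
  have "sum_list (map weight cs) = length cs + (\<Sum>c\<leftarrow>cs. of_bool (hot c))" for cs :: "('a, 'b) bptree list"
    by (induction cs) (auto simp: weight_def)
  from this[of "t0 # map snd es"] show ?thesis by simp
qed

text \<open>Truncated subtraction does no harm: with \<open>n\<close> children, \<open>e\<close> of
  them hot, critical or unsafe means \<open>ci - n \<le> e\<close>, that is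
  \<open>ci \<le> n + e\<close>, and \<open>n + e\<close> is the load by
  \<open>load_eq\<close>.\<close>

lemma hot_iff: "hot t \<longleftrightarrow> cap t \<le> load t"
proof (cases t)
  case (Node t0 es)
  show ?thesis unfolding Node critical.simps unsafe.simps free_space.simps load_eq cap.simps
    by arith
qed auto

text \<open>The invariant turns the inequality of \<open>hot_iff\<close> into an equation; it
  excludes overfull nodes, whose \<open>free_space\<close> is truncated to 0.\<close>

lemma critical_iff: "within t \<Longrightarrow> critical cl ci t \<longleftrightarrow> load t = cap t"
proof (cases t)
  case (Node t0 es)
  assume "within t"
  then have "load t \<le> ci" using within_load Node by force
  then show ?thesis unfolding Node critical.simps free_space.simps load_eq cap.simps
    by arith
qed auto

section \<open>The lowest critical node on the search path\<close>

abbreviation lowest :: "'k::linorder \<Rightarrow> ('k, 'v) bptree \<Rightarrow> nat option" where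
  "lowest k t \<equiv> last_critical cl ci k 0 None t"

text \<open>Removes the accumulator: it survives only if nothing on the path is critical, and the
  starting depth is a mere offset.\<close>

lemma last_critical_acc:
  "last_critical cl ci k d l t =
     (case lowest k t of None \<Rightarrow> l | Some e \<Rightarrow> Some (d + e))"
proof (induction t arbitrary: d l rule: measure_induct_rule[of size])
  case (less t)
  show ?case
  proof (cases t)
    case (Node t0 es)
    let ?c = "chd (Node t0 es) ! child_index k es"
    have "size ?c < size t" using size_child Node by blast
    note IH = less.IH[OF this]
    show ?thesis unfolding Node last_critical.simps(2)
      by (subst (1 2) IH) (auto split: option.splits)
  qed simp
qed

lemma lowest_Node:
  "lowest k (Node t0 es) =
     (case lowest k (chd (Node t0 es) ! child_index k es) of
        None \<Rightarrow> if critical cl ci (Node t0 es) then Some 0 else None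
      | Some e \<Rightarrow> Some (Suc e))"
  unfolding last_critical.simps(2)
  by (subst last_critical_acc) (auto split: option.splits)

declare last_critical.simps(2) [simp del] critical.simps(2) [simp del] unsafe.simps(2) [simp del]

text \<open>The node \<open>t\<close> itself lies on the path, so it is not critical, and the
  invariant leaves only a load below the capacity.\<close>

lemma lowest_None_cold: "within t \<Longrightarrow> lowest k t = None \<Longrightarrow> load t < cap t"
  using within_load[of t] critical_iff[of t]
  by (cases t) (auto simp: lowest_Node split: option.splits if_splits)

lemma lowest_Some0_critical: "within t \<Longrightarrow> lowest k t = Some 0 \<Longrightarrow> load t = cap t"
  using critical_iff[of t]
  by (cases t) (auto simp: lowest_Node split: option.splits if_splits)

lemma child_in: "chd (Node t0 es) ! child_index k es \<in> set (t0 # map snd es)"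
  using nth_mem[OF child_index_less[of k es t0]] by simp

lemma within_child: "within (Node t0 es) \<Longrightarrow> within (chd (Node t0 es) ! child_index k es)"
  using child_in[of t0 es k] unfolding within_Node by blast

section \<open>Insertion along the search path\<close>

lemma replace_child_props:
  fixes k :: "'k::linorder" and t0 :: "('k, 'v) bptree" and es :: "('k \<times> ('k, 'v) bptree) list"
  defines "i \<equiv> child_index k es" and "N \<equiv> Node t0 es"
  assumes N: "within N" and u: "within u"
  shows "load (replace_child i u t0 es) + weight (chd N ! i) = load N + weight u"
    and "cap (replace_child i u t0 es) = ci"
    and "load (replace_child i u t0 es) \<le> ci \<Longrightarrow> within (replace_child i u t0 es)"
    and "\<exists>t1 es1. replace_child i u t0 es = Node t1 es1 \<and> chd (Node t1 es1) ! child_index k es1 = u"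
proof -
  have i: "i \<le> length es" unfolding i_def by (rule child_index_le)
  obtain t1 es1 where r: "replace_child i u t0 es = Node t1 es1" "map fst es1 = map fst es"
    "t1 # map snd es1 = (t0 # map snd es)[i := u]"
    by (rule replace_child_Node[OF i])
  let ?ws = "map weight (t0 # map snd es)"
  have len: "i < length ?ws" using i by simp
  have nth: "?ws ! i = weight (chd N ! i)"
    using i unfolding N_def chd.simps by (subst nth_map) auto
  \<comment> \<open>Makes the truncated subtraction in \<open>sum_list_update\<close> exact.\<close>
  have "?ws ! i \<le> sum_list ?ws" using len by (rule elem_le_sum_list)
  then have "sum_list (map weight ((t0 # map snd es)[i := u])) + weight (chd N ! i)
     = sum_list ?ws + weight u"
    using sum_list_update[OF len, of "weight u"] unfolding map_update nth by linarith
  then show "load (replace_child i u t0 es) + weight (chd N ! i) = load N + weight u"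
    unfolding r load.simps N_def by (simp only: r(3))
  show "cap (replace_child i u t0 es) = ci" by (simp add: r)
  show "within (replace_child i u t0 es)" if "load (replace_child i u t0 es) \<le> ci"
    using N u that set_update_subset_insert[of "t0 # map snd es" i u]
    unfolding r N_def within_Node load.simps r(3) by blast
  show "\<exists>t1 es1. replace_child i u t0 es = Node t1 es1 \<and> chd (Node t1 es1) ! child_index k es1 = u"
  proof (intro exI conjI)
    show "replace_child i u t0 es = Node t1 es1" by (rule r)
    \<comment> \<open>The child index depends only on the separators, which the replacement
      keeps.\<close>
    have "child_index k es1 = i" unfolding i_def child_index_seps r(2) ..
    then show "chd (Node t1 es1) ! child_index k es1 = u"
      unfolding chd.simps r(3) using i by (simp del: list_update.simps)
  qed
qed

lemma leaf_insert_Node: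
  assumes "leaf_insert cl ci mid k v (chd (Node t0 es) ! child_index k es) = (Whole u, n)"
  shows "leaf_insert cl ci mid k v (Node t0 es) = (Whole (replace_child (child_index k es) u t0 es), n)"
  using assms by (simp add: Let_def)

lemma fits_replace_child:
  assumes "fits k (inorder (chd (Node t0 es) ! child_index k es)) (inorder u)"
  shows "fits k (inorder (Node t0 es)) (inorder (replace_child (child_index k es) u t0 es))"
  by (rule inorder_context[of k es t0]) (use assms in metis)

text \<open>The child on the path is cold, so its weight rises at most from 1 to 2 and the load of
  its parent by at most 1; \<open>load t < cap t\<close> leaves room for that.\<close>

lemma insert_noncritical_path:
  assumes "within t" "lowest k t = None"
  shows "\<exists>u. leaf_insert cl ci mid k v t = (Whole u, 0) \<and> within u \<and> load u \<le> Suc (load t) \<and>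
    cap u = cap t \<and> fits k (inorder t) (inorder u)"
  using assms
proof (induction t rule: measure_induct_rule[of size])
  case (less t)
  have cold: "load t < cap t" using lowest_None_cold less.prems by blast
  show ?case
  proof (cases t)
    case (Leaf es)
    then show ?thesis using cold length_upsert[of k v es] fits_upsert[of k es v]
      by (simp add: Let_def)
  next
    case (Node t0 es)
    let ?c = "chd (Node t0 es) ! child_index k es"
    have "size ?c < size t" using size_child Node by blast
    moreover have wc: "within ?c" using less.prems Node within_child by blast
    moreover have lc: "lowest k ?c = None"
      using less.prems Node by (auto simp: lowest_Node split: option.splits)
    ultimately obtain u where u: "leaf_insert cl ci mid k v ?c = (Whole u, 0)" "within u"
      "fits k (inorder ?c) (inorder u)"
      using less.IH by blast
    note wN = less.prems(1)[unfolded Node]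
    have "weight ?c = 1"
      using hot_iff[of ?c] lowest_None_cold[OF wc lc] by (auto simp: weight_def)
    moreover have "weight u \<le> 2" by (simp add: weight_def)
    ultimately have "load (replace_child (child_index k es) u t0 es) \<le> Suc (load t)"
      using replace_child_props(1)[OF wN u(2), of k] unfolding Node by simp
    then show ?thesis
      using leaf_insert_Node[OF u(1)] replace_child_props(2,3)[OF wN u(2), of k] cold
        fits_replace_child[OF u(3)] unfolding Node by simp
  qed
qed

text \<open>
  The state between the proactive split and the insertion: some node of the search path, with
  nothing critical from there on, stays below its capacity when it gains weight 1.
\<close>

inductive ready :: "'k::linorder \<Rightarrow> ('k, 'v) bptree \<Rightarrow> bool" for k where
  here: "lowest k t = None \<Longrightarrow> load t + 2 \<le> cap t \<Longrightarrow> ready k t"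
| below: "ready k (chd (Node t0 es) ! child_index k es) \<Longrightarrow> ready k (Node t0 es)"

text \<open>At the \<open>here\<close> node the gap of 2 shrinks by at most 1, so the node stays
  cold; above it the weight of the child on the path, and with it the load, is unchanged.\<close>

lemma insert_ready:
  assumes "ready k t" "within t"
  shows "\<exists>u. leaf_insert cl ci mid k v t = (Whole u, 0) \<and> within u \<and> hot u = hot t \<and>
    fits k (inorder t) (inorder u)"
  using assms
proof induction
  case (here t)
  obtain u where u: "leaf_insert cl ci mid k v t = (Whole u, 0)" "within u" "load u \<le> Suc (load t)"
    "cap u = cap t" "fits k (inorder t) (inorder u)"
    using insert_noncritical_path[OF here(3,1)] by blast
  then have "hot u = hot t" using here hot_iff[of t] hot_iff[of u] by simp
  then show ?case using u by blast
next
  case (below t0 es)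
  let ?c = "chd (Node t0 es) ! child_index k es"
  obtain u where u: "leaf_insert cl ci mid k v ?c = (Whole u, 0)" "within u"
    "hot u = hot ?c" "fits k (inorder ?c) (inorder u)"
    using below.IH within_child[OF below.prems] by blast
  have "weight ?c = weight u" using u(3) by (simp add: weight_def)
  then have "load (replace_child (child_index k es) u t0 es) = load (Node t0 es)"
    using replace_child_props(1)[OF below.prems u(2), of k] by simp
  moreover have "load (Node t0 es) \<le> ci" using within_load[OF below.prems] by simp
  ultimately show ?case
    using leaf_insert_Node[OF u(1)] replace_child_props(2,3)[OF below.prems u(2), of k]
      fits_replace_child[OF u(4)] hot_iff by (metis cap.simps(2))
qed

section \<open>The proactive split of the lowest critical node\<close>

lemma weight_bounds: "length cs \<le> sum_list (map weight cs)" "sum_list (map weight cs) \<le> 2 * length cs"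
  by (induction cs) (auto simp: weight_def)

text \<open>Applied to the cold child on the search path, this bounds the number of children of a
  critical node from below and the load of a small half from above.\<close>

lemma weight_bound_cold: "c \<in> set cs \<Longrightarrow> \<not> hot c \<Longrightarrow> sum_list (map weight cs) < 2 * length cs"
proof -
  assume "c \<in> set cs" "\<not> hot c"
  then obtain a b where "cs = a @ c # b" "weight c = 1"
    by (auto dest: split_list simp: weight_def)
  then show ?thesis using weight_bounds(2)[of a] weight_bounds(2)[of b] by simp
qed

text \<open>Only the half that the search for \<open>k\<close> enters has to be
  \<open>ready\<close>, whereas both must be cold for the weight seen by the parent to stay the
  same.\<close>

lemma split_node_critical:
  fixes t :: "('k::linorder, 'v) bptree"
  assumes w: "within t" and so: "sorted (inorder t)" and low: "lowest k t = Some 0"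
  shows "\<exists>l s r. split_node mid t = Split l s r \<and> within l \<and> within r \<and> \<not> hot l \<and> \<not> hot r \<and>
    ready k (if s \<le> k then r else l) \<and> fits k (inorder t) (inorder l @ s # inorder r)"
proof (cases t)
  case (Leaf es)
  define m where "m = mid (length es)"
  have n: "length es = cl" using lowest_Some0_critical[OF w low] Leaf by simp
  \<comment> \<open>As \<open>cl \<ge> 4\<close>, each half gets at least two entries whichever way
    \<open>mid\<close> rounds, so the other half is at least 2 below capacity.\<close>
  have m: "m \<ge> 2" "m + 2 \<le> cl" using mid[of "length es"] cl n unfolding m_def by auto
  let ?l = "Leaf (take m es)" and ?r = "Leaf (drop m es)"
  have "ready k ?l" by (rule here) (use m n in simp_all)
  moreover have "ready k ?r" by (rule here) (use m n in simp_all)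
  moreover have "fits k (inorder t) (inorder ?l @ fst (es ! m) # inorder ?r)"
    unfolding fits_def
  proof (intro allI impI)
    fix xs ys assume "sorted (xs @ inorder t @ ys)"
    moreover have "es = take m es @ es ! m # drop (Suc m) es"
      using m n by (simp add: id_take_nth_drop[symmetric])
    moreover have "drop m es = es ! m # drop (Suc m) es"
      using m n by (simp add: Cons_nth_drop_Suc)
    ultimately have "sorted (xs @ map fst (take m es @ es ! m # drop (Suc m) es) @ ys)"
      "drop m es = es ! m # drop (Suc m) es"
      using Leaf by auto
    \<comment> \<open>The separator of a leaf split copies the first key of the right half;
      \<open>sorted\<close> admits the duplicate.\<close>
    then show "sorted (xs @ (inorder ?l @ fst (es ! m) # inorder ?r) @ ys)"
      by (auto simp: sorted_append)
  qed
  ultimately show ?thesis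
    using m n Leaf by (auto simp: m_def Let_def)
next
  case (Node t0 es)
  define n where "n = Suc (length es)"
  define m where "m = mid n"
  let ?c = "chd (Node t0 es) ! child_index k es"
  have wc: "within ?c" using within_child w Node by blast
  have lc: "lowest k ?c = None"
    using low Node by (auto simp: lowest_Node split: option.splits)
  then have cold: "\<not> hot ?c" using hot_iff[of ?c] lowest_None_cold[OF wc lc] by simp
  have ld: "sum_list (map weight (t0 # map snd es)) = ci"
    using lowest_Some0_critical[OF w low] Node by simp
  \<comment> \<open>The load is \<open>ci \<ge> 5\<close>, and because of the cold child it is less
    than \<open>2 * n\<close>.\<close>
  have n3: "n \<ge> 3"
    using weight_bound_cold[OF child_in cold] ld ci by (simp add: n_def)
  have m: "m \<ge> 1" "m < n" "n \<ge> 4 \<Longrightarrow> m \<ge> 2 \<and> m + 2 \<le> n"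
    using mid[of n] n3 unfolding m_def by auto
  obtain s u where su: "es ! (m - 1) = (s, u)" by fastforce
  let ?a = "take (m - 1) es" and ?b = "drop m es"
  have es: "es = ?a @ (s, u) # ?b"
    using m su id_take_nth_drop[of "m - 1" es] by (simp add: n_def)
  let ?l = "Node t0 ?a" and ?r = "Node u ?b"
  have la: "length ?a = m - 1" using m by (simp add: n_def)
  have lb: "length ?b = n - Suc m" by (simp add: n_def)
  have cs: "t0 # map snd es = (t0 # map snd ?a) @ (u # map snd ?b)"
    by (subst es) simp
  have sum: "load ?l + load ?r = ci" using ld unfolding cs by simp
  have bl: "m \<le> load ?l" "load ?l \<le> 2 * m" and br: "n - m \<le> load ?r" "load ?r \<le> 2 * (n - m)"
  proof -
    have "length (t0 # map snd ?a) = m" "length (u # map snd ?b) = n - m"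
      using la lb m by auto
    then show "m \<le> load ?l" "load ?l \<le> 2 * m" "n - m \<le> load ?r" "load ?r \<le> 2 * (n - m)"
      using weight_bounds[of "t0 # map snd ?a"] weight_bounds[of "u # map snd ?b"]
      unfolding load.simps by metis+
  qed
  have wl: "within ?l" and wr: "within ?r"
    using w Node cs sum unfolding Node within_Node by auto
  \<comment> \<open>The two loads add up to \<open>ci\<close> and neither half is without children,
    so both stay below \<open>ci\<close>.\<close>
  have cl: "\<not> hot ?l" and cr: "\<not> hot ?r" using hot_iff[of ?l] hot_iff[of ?r] sum bl br m by auto
  \<comment> \<open>For \<open>n \<ge> 4\<close> each half has at least two children, so the load of
    the other is at most \<open>ci - 2\<close>. The second premise serves \<open>n = 3\<close>: with
    \<open>ci = 5\<close>, child weights 2, 2, 1 can leave a half of load 4, but that half lacks the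
    cold child.\<close>
  have roomy: "load x + 2 \<le> cap x"
    if "x \<in> {?l, ?r}" "\<And>t1 es1. x = Node t1 es1 \<Longrightarrow> ?c \<in> set (t1 # map snd es1)" for x
  proof (cases "n \<ge> 4")
    case True
    then show ?thesis using that m(3) sum bl br by auto
  next
    case False
    \<comment> \<open>Here \<open>n = 3\<close>, and a half may have two children; it is saved by the cold child on the path.\<close>
    from that(1) obtain t1 es1 where x: "x = Node t1 es1" by auto
    have "length (t1 # map snd es1) \<le> 2"
      using that(1) x la lb m False by auto
    then show ?thesis
      using weight_bound_cold[OF that(2)[OF x] cold] ci x by simp
  qed
  have "ready k (if s \<le> k then ?r else ?l)"
  proof (cases "s \<le> k")
    case True
    \<comment> \<open>The key order enters here: the separators left of \<open>s\<close> are
      \<open>\<le> s \<le> k\<close>, so the search passes them all and continues in the right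
      half.\<close>
    have "sorted (inorder (Node t0 (?a @ (s, u) # ?b)))" using so Node es by simp
    then have "x \<le> s" if "(x, y) \<in> set ?a" for x y
      using that by (fastforce simp: sorted_append)
    then have "\<forall>e\<in>set (?a @ [(s, u)]). (\<lambda>(x, _). x \<le> k) e" using True by fastforce
    then have "child_index k ((?a @ [(s, u)]) @ ?b) = length (?a @ [(s, u)]) + child_index k ?b"
      unfolding child_index_def by (subst takeWhile_append2) auto
    then have "child_index k es = m + child_index k ?b" using es la m by simp
    then have ch: "?c = chd ?r ! child_index k ?b"
      unfolding chd.simps cs using la m by (subst nth_append_right) auto
    have "lowest k ?r = None" using lc ch cr by (simp add: lowest_Node)
    moreover have "?c \<in> set (u # map snd ?b)" using ch child_in by metis
    ultimately show ?thesis using True roomy[of ?r] by (auto intro!: here)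
  next
    case False
    then have ci: "child_index k es = child_index k ?a"
      by (subst es) (simp add: child_index_def takeWhile_tail)
    then have ch: "?c = chd ?l ! child_index k ?a"
      using child_index_less[of k ?a t0] unfolding chd.simps cs by (simp only: nth_append_left)
    have "lowest k ?l = None" using lc ch cl by (simp add: lowest_Node)
    moreover have "?c \<in> set (t0 # map snd ?a)" using ch child_in by metis
    ultimately show ?thesis using False roomy[of ?l] by (auto intro!: here)
  qed
  moreover have "split_node mid t = Split ?l s ?r"
    using su Node by (simp add: m_def n_def Let_def)
  moreover have "inorder t = inorder ?l @ s # inorder ?r"
    unfolding Node by (subst es) simp
  moreover have "fits k xs xs" for xs by (simp add: fits_def)
  ultimately show ?thesis using wl wr cl cr by metis
qed

text \<open>Passes from the split node to its parent: weight 2 is traded for 1 + 1, so the parent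
  keeps its load and its \<open>hot\<close> status.\<close>

lemma split_child:
  fixes k :: "'k::linorder" and t0 :: "('k, 'v) bptree" and es :: "('k \<times> ('k, 'v) bptree) list"
  defines "i \<equiv> child_index k es" and "N \<equiv> Node t0 es"
  assumes N: "within N" and hot: "hot (chd N ! i)"
    and l: "within l" "\<not> hot l" and r: "within r" "\<not> hot r"
    and ready: "ready k (if s \<le> k then r else l)"
    and fits: "fits k (inorder (chd N ! i)) (inorder l @ s # inorder r)"
  shows "\<exists>t'. absorb cl ci mid t0 es i (Split l s r, 0) = (Whole t', 0) \<and> within t' \<and>
    hot t' = hot N \<and> ready k t' \<and> fits k (inorder N) (inorder t')"
proof -
  have i: "i \<le> length es" unfolding i_def by (rule child_index_le)
  obtain t1 es1 where e: "add_entry i s r (replace_child i l t0 es) = Node t1 es1"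
    "map fst es1 = take i (map fst es) @ s # drop i (map fst es)"
    "t1 # map snd es1 = take i (t0 # map snd es) @ l # r # drop (Suc i) (t0 # map snd es)"
    by (rule add_entry_Node[OF i])
  let ?cs = "t0 # map snd es"
  have cs: "?cs = take i ?cs @ chd N ! i # drop (Suc i) ?cs"
    using i id_take_nth_drop[of i ?cs] by (simp add: N_def)
  have "sum_list (map weight ?cs) = sum_list (map weight (t1 # map snd es1))"
    unfolding e by (subst cs) (use hot l r in \<open>simp add: weight_def\<close>)
  then have ld: "load (Node t1 es1) = load N" unfolding N_def by simp
  have "set (t1 # map snd es1) \<subseteq> set ?cs \<union> {l, r}"
    unfolding e using set_take_subset[of i ?cs] set_drop_subset[of "Suc i" ?cs] by auto
  then have w: "within (Node t1 es1)"
    using N l(1) r(1) ld unfolding N_def within_Node load.simps by (auto simp only:)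
  \<comment> \<open>The hot child counts 2 and every other child at least 1; since the load is at
    most \<open>ci\<close>, the excess over the number of children is a free slot.\<close>
  have "length ?cs < sum_list (map weight ?cs)"
  proof -
    have "length (take i ?cs) + length (drop (Suc i) ?cs) + 1 = length ?cs"
      by (subst (3) cs) simp
    moreover have "sum_list (map weight ?cs) =
      sum_list (map weight (take i ?cs)) + 2 + sum_list (map weight (drop (Suc i) ?cs))"
      by (subst cs) (use hot in \<open>simp add: weight_def\<close>)
    ultimately show ?thesis
      using weight_bounds(1)[of "take i ?cs"] weight_bounds(1)[of "drop (Suc i) ?cs"] by linarith
  qed
  then have free: "free_space cl ci (Node t0 es) > 0"
    using N by (simp add: N_def)
  \<comment> \<open>The separator \<open>s\<close> is entered where the search for \<open>k\<close>
    stopped, so \<open>s \<le> k\<close> moves the search on by exactly one place.\<close>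
  have "child_index k es1 = (if s \<le> k then Suc i else i)"
    unfolding child_index_seps e i_def by (rule takeWhile_insert)
  then have "chd (Node t1 es1) ! child_index k es1 = (if s \<le> k then r else l)"
    unfolding chd.simps e using i by (simp add: nth_append)
  then have "ready k (Node t1 es1)" using ready by (auto intro: below)
  moreover have "fits k (inorder N) (inorder (Node t1 es1))"
  proof (rule inorder_context[of k es t0, folded i_def N_def])
    fix pre post
    assume add: "\<And>l s r. inorder (add_entry i s r (replace_child i l t0 es)) =
        pre @ inorder l @ s # inorder r @ post"
      and ctx: "\<And>bs. fits k (inorder (chd N ! i)) bs \<Longrightarrow> fits k (inorder N) (pre @ bs @ post)"
    show "fits k (inorder N) (inorder (Node t1 es1))"
      using ctx[OF fits] add[of s r l] unfolding e(1) by simp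
  qed
  moreover have "hot (Node t1 es1) = hot N" using hot_iff[of N] hot_iff[of "Node t1 es1"] ld
    by (simp add: N_def)
  ultimately show ?thesis using free w e(1) by (simp add: Let_def)
qed

text \<open>Depth 0 is left out because its outcome is a \<open>Split\<close>. The parent of the
  split node is the base case; further up, an unchanged \<open>hot\<close> status of the child means
  an unchanged load.\<close>

lemma split_at_lowest:
  fixes t :: "('k::linorder, 'v) bptree"
  assumes "within t" "sorted (inorder t)" "lowest k t = Some (Suc d)"
  shows "\<exists>u. split_at cl ci mid k (Suc d) t = (Whole u, 0) \<and> within u \<and>
    hot u = hot t \<and> ready k u \<and> fits k (inorder t) (inorder u)"
  using assms
proof (induction d arbitrary: t rule: less_induct)
  case (less d)
  from less.prems(3) obtain t0 es where t: "t = Node t0 es" by (cases t) (auto split: if_splits)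
  let ?i = "child_index k es"
  let ?c = "chd (Node t0 es) ! ?i"
  note N = less.prems(1)[unfolded t]
  have c: "within ?c" "sorted (inorder ?c)"
    using within_child[OF N] sorted_inorder_child less.prems(2) unfolding t by blast+
  have low: "lowest k ?c = Some d"
    using less.prems(3) unfolding t by (auto simp: lowest_Node split: option.splits if_splits)
  have sp: "split_at cl ci mid k (Suc d) t = absorb cl ci mid t0 es ?i (split_at cl ci mid k d ?c)"
    by (simp add: t Let_def)
  show ?case
  proof (cases d)
    case 0
    obtain l s r where lsr: "split_node mid ?c = Split l s r" "within l" "within r"
      "\<not> hot l" "\<not> hot r" "ready k (if s \<le> k then r else l)"
      "fits k (inorder ?c) (inorder l @ s # inorder r)"
      using split_node_critical[OF c low[unfolded 0]] by blast
    have "hot ?c" using hot_iff lowest_Some0_critical[OF c(1) low[unfolded 0]] by force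
    from split_child[OF N this lsr(2,4,3,5,6,7)] show ?thesis
      unfolding sp unfolding 0 split_at.simps lsr(1) t .
  next
    case (Suc d')
    then obtain u where u: "split_at cl ci mid k d ?c = (Whole u, 0)" "within u"
      "hot u = hot ?c" "ready k u" "fits k (inorder ?c) (inorder u)"
      using less.IH[of d' ?c] c low by blast
    have "weight ?c = weight u" using u(3) by (simp add: weight_def)
    then have "load (replace_child ?i u t0 es) = load (Node t0 es)"
      using replace_child_props(1)[OF N u(2), of k] by simp
    moreover have "load (Node t0 es) \<le> ci" using within_load[OF N] by simp
    ultimately have w: "within (replace_child ?i u t0 es)"
      and h: "hot (replace_child ?i u t0 es) = hot (Node t0 es)"
      using replace_child_props(2,3)[OF N u(2), of k] hot_iff[of "Node t0 es"]
        hot_iff[of "replace_child ?i u t0 es"] by simp_all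
    obtain t1 es1 where "replace_child ?i u t0 es = Node t1 es1"
      "chd (Node t1 es1) ! child_index k es1 = u"
      using replace_child_props(4)[OF N u(2), of k] by blast
    then have "ready k (replace_child ?i u t0 es)"
      using u(4) below[of k t1 es1] by simp
    then show ?thesis
      unfolding sp unfolding u(1) t absorb.simps(1) using w h fits_replace_child[OF u(5)] by blast
  qed
qed

section \<open>One complete insertion and the invariant of \<open>ffbtree\<close>\<close>

lemma ffb_insert_no_forced_split:
  fixes t :: "('k::linorder, 'v) bptree"
  assumes w: "within t" and so: "sorted (inorder t)"
  shows "\<exists>u. ffb_insert cl ci mid k v t = (u, 0) \<and> within u \<and> sorted (inorder u)"
proof (cases "lowest k t")
  case None
  then show ?thesis using insert_noncritical_path[OF w None, of v] fits_sorted[OF _ so]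
    by (auto simp: ffb_insert_def)
next
  case (Some d)
  have "\<exists>t1. apfst new_root (split_at cl ci mid k d t) = (t1, 0) \<and> within t1 \<and> ready k t1 \<and>
    fits k (inorder t) (inorder t1)"
  proof (cases d)
    case 0
    obtain l s r where lsr: "split_node mid t = Split l s r" "within l" "within r"
      "\<not> hot l" "\<not> hot r" "ready k (if s \<le> k then r else l)"
      "fits k (inorder t) (inorder l @ s # inorder r)"
      using split_node_critical[OF w so] Some 0 by blast
    \<comment> \<open>With the single separator \<open>s\<close>, the search in the new root goes to
      \<open>r\<close> if \<open>s \<le> k\<close> and to \<open>l\<close> otherwise.\<close>
    have "ready k (Node l [(s, r)])"
      using lsr(6) by (intro below) (auto simp: child_index_def)
    \<comment> \<open>Two cold children give the new root load 2.\<close>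
    moreover have "within (Node l [(s, r)])"
      using lsr ci by (simp add: weight_def)
    ultimately show ?thesis using lsr 0 by simp
  next
    case (Suc d')
    then show ?thesis using split_at_lowest[OF w so, of k d'] Some by auto
  qed
  then obtain t1 where t1: "apfst new_root (split_at cl ci mid k d t) = (t1, 0)" "within t1"
    "ready k t1" "fits k (inorder t) (inorder t1)" by blast
  obtain u where "leaf_insert cl ci mid k v t1 = (Whole u, 0)" "within u"
    "fits k (inorder t1) (inorder u)"
    using insert_ready[OF t1(3,2)] by blast
  then show ?thesis using t1 Some fits_sorted[OF _ fits_sorted[OF t1(4) so]]
    by (auto simp: ffb_insert_def)
qed

lemma ffbtree_invariant: "ffbtree cl ci mid t \<Longrightarrow> within t \<and> sorted (inorder t)"
proof (induction rule: ffbtree.induct)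
  case (insert t k v)
  then show ?case using ffb_insert_no_forced_split[of t k v] by auto
qed simp

end

theorem theorem1:
  fixes cl ci :: nat and mid :: "nat \<Rightarrow> nat"
    and t :: "('k::linorder, 'v) bptree" and k :: 'k and v :: 'v
  assumes "cl \<ge> 4" and "ci \<ge> 5"
    and "\<And>n. mid n = n div 2 \<or> mid n = n - n div 2"
    and "ffbtree cl ci mid t"
  shows "\<not> split_propagates cl ci mid t k v"
proof -
  interpret ffb cl ci mid using assms(1-3) by unfold_locales
  show ?thesis
    using ffbtree_invariant[OF assms(4)] ffb_insert_no_forced_split[of t k v]
    by (auto simp: split_propagates_def)
qed

end
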